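(* Let $d\ge 1$ be an integer, let $\vec{\gamma}=(\gamma_1,\dots,\gamma_d)$ be a $d$-tuple of complex numbers, and let $b,\beta$ be non-zero complex numbers. Let $L$ be the Riemann surface of the logarithm, let $g:L\to\mathbb{C}$, $g(z)=1+bz^{\beta}$, and let $\alpha\in L$ be a zero of $g$. For $\vec a=(a_1,\dots,a_d)\in\mathbb{C}^d$ let $f(z;\vec a)=g(z)+\sum_{i=1}^d a_i z^{\gamma_i}$ for $z\in L$. Suppose there are a neighborhood $U$ of $\vec 0$ in $\mathbb{C}^d$ and a function $\phi:U\to L$, differentiable in the variables $a_1,\dots,a_d$ at $\vec 0$ for all orders, such that $$f(\phi(\vec a);\vec a)=0\ \text{ for all }\vec a\in U,\qquad \phi(\vec 0)=\alpha .$$ Then for every $d$-tuple $\vec n=(n_1,\dots,n_d)$ of non-negative integers with $\Sigma\vec n:=\sum_{i=1}^d n_i\ge 1$, $$\left.\left(\prod_{i=1}^d\Big(\frac{\partial}{\partial a_i}\Big)^{n_i}\right)\phi(\vec a)\right|_{\vec a=\vec 0} = -\frac{\alpha^{1+\sum_{i=1}^d n_i(\gamma_i-1)}}{g'(\alpha)^{\Sigma\vec n}}\ \prod_{j=1}^{\Sigma\vec n-1}\Big(-1+j\beta-\sum_{i=1}^d n_i\gamma_i\Big),$$ where $g'(\alpha)=b\beta\alpha^{\beta-1}$.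
   Context: The Riemann surface $L$ of the logarithm is parametrized by $L=\{(r,\theta,n): r\in\mathbb{R}^+,\ \theta\in(-\pi,\pi],\ n\in\mathbb{Z}\}$. For $z\in L$ corresponding to $(r,\theta,n)$ and $\gamma\in\mathbb{C}$, the complex power is $z^{\gamma}=e^{\gamma\ln(r)+i\gamma\theta+2\pi i n\gamma}\in\mathbb{C}$ (here $i=\sqrt{-1}$). The topology and complex structure on $L$ are the usual ones, for which $\log z=\ln r+i\theta+2\pi i n$ is a bijective coordinate onto $\mathbb{C}$; the map $z\mapsto z^1=re^{i\theta}$ is a local coordinate, and partial derivatives of the $L$-valued function $\phi$ are taken in this coordinate (i.e. they are the complex partial derivatives of the $\mathbb{C}$-valued function $\phi(\vec a)^1$). A zero $\alpha$ of $g$ in $L$ always exists. An empty product equals $1$. *)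

theory Defs
  imports "HOL-Complex_Analysis.Complex_Analysis"
begin

typedef log_surface =
  "{(r::real, \<theta>::real, n::int). 0 < r \<and> - pi < \<theta> \<and> \<theta> \<le> pi}"
  by (rule exI[of _ "(1, 0, 0)"]) simp

definition lpow :: "log_surface \<Rightarrow> complex \<Rightarrow> complex" where
  "lpow z \<gamma> = (case Rep_log_surface z of (r, \<theta>, n) \<Rightarrow>
     exp (\<gamma> * of_real (ln r) + \<i> * \<gamma> * of_real \<theta> + 2 * of_real pi * \<i> * of_int n * \<gamma>))"

definition llog :: "log_surface \<Rightarrow> complex" where
  "llog z = (case Rep_log_surface z of (r, \<theta>, n) \<Rightarrow>
     of_real (ln r) + \<i> * of_real \<theta> + 2 * of_real pi * \<i> * of_int n)"

lemma lpow_eq_exp_llog: "lpow z \<gamma> = exp (\<gamma> * llog z)"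
  by (cases "Rep_log_surface z") (simp add: lpow_def llog_def algebra_simps)

lemma bij_llog: "bij llog"
proof (rule bijI)
  show "inj llog"
  proof (rule injI)
    fix x y assume eq: "llog x = llog y"
    obtain r t n where x: "Rep_log_surface x = (r, t, n)" by (cases "Rep_log_surface x")
    obtain s u m where y: "Rep_log_surface y = (s, u, m)" by (cases "Rep_log_surface y")
    have xb: "0 < r" "- pi < t" "t \<le> pi" using Rep_log_surface[of x] x by auto
    have yb: "0 < s" "- pi < u" "u \<le> pi" using Rep_log_surface[of y] y by auto
    have re: "ln r = ln s" and im: "t + 2 * pi * n = u + 2 * pi * m"
      using eq by (auto simp: llog_def x y complex_eq_iff)
    have "2 * pi * real_of_int (n - m) = u - t" using im by (simp add: algebra_simps)
    moreover have "\<bar>u - t\<bar> < 2 * pi * 1" using xb yb by linarith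
    ultimately have "\<bar>2 * pi * real_of_int (n - m)\<bar> < 2 * pi * 1" by simp
    then have "\<bar>real_of_int (n - m)\<bar> < 1" by (simp add: abs_mult)
    then have "n = m" by linarith
    moreover have "r = s" using re xb yb by simp
    ultimately show "x = y" using im x y by (simp flip: Rep_log_surface_inject)
  qed
  show "surj llog"
  proof (rule surjI)
    fix w :: complex
    define n where "n = \<lceil>(Im w - pi) / (2 * pi)\<rceil>"
    define t where "t = Im w - 2 * pi * n"
    have "(Im w - pi) / (2 * pi) \<le> n" "n < (Im w - pi) / (2 * pi) + 1"
      unfolding n_def by linarith+
    then have "- pi < t \<and> t \<le> pi" by (simp add: t_def field_simps)
    then have "llog (Abs_log_surface (exp (Re w), t, n)) = w"
      by (simp add: llog_def Abs_log_surface_inverse complex_eq_iff t_def)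
    then show "llog ((\<lambda>w. Abs_log_surface
      (exp (Re w), Im w - 2 * pi * \<lceil>(Im w - pi) / (2 * pi)\<rceil>, \<lceil>(Im w - pi) / (2 * pi)\<rceil>)) w) = w"
      by (simp add: t_def n_def)
  qed
qed

definition partial_deriv ::
    "'d::finite \<Rightarrow> (complex ^ 'd \<Rightarrow> complex) \<Rightarrow> complex ^ 'd \<Rightarrow> complex" where
  "partial_deriv i F a = deriv (\<lambda>t. F (a + axis i t)) 0"

text \<open>
  A list \<open>[i\<^sub>1, \<dots>, i\<^sub>k]\<close> of coordinate indices stands for the operator
  \<open>(\<partial>/\<partial>a\<^bsub>i\<^sub>1\<^esub>) \<dots> (\<partial>/\<partial>a\<^bsub>i\<^sub>k\<^esub>)\<close>; the last index is differentiated first.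
\<close>
primrec iter_partial ::
    "'d::finite list \<Rightarrow> (complex ^ 'd \<Rightarrow> complex) \<Rightarrow> complex ^ 'd \<Rightarrow> complex" where
  "iter_partial [] F = F"
| "iter_partial (i # w) F = partial_deriv i (iter_partial w F)"

text \<open>
  \<^const>\<open>deriv\<close> is total, so the existence of an iterated derivative at a point is a
  separate predicate. To differentiate along the \<open>i\<close>-th axis at \<open>a\<close>, the preceding
  derivative must exist at all points of that axis line close to \<open>a\<close>.
\<close>
primrec partials_exist ::
    "'d::finite list \<Rightarrow> (complex ^ 'd \<Rightarrow> complex) \<Rightarrow> complex ^ 'd \<Rightarrow> bool" where
  "partials_exist [] F a \<longleftrightarrow> True"
| "partials_exist (i # w) F a \<longleftrightarrow>
     (\<forall>\<^sub>F t in nhds 0. partials_exist w F (a + axis i t)) \<and>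
     (\<lambda>t. iter_partial w F (a + axis i t)) field_differentiable at 0"

text \<open>
  Differentiability of all orders for a map into the Riemann surface, expressed in its
  global chart \<^const>\<open>llog\<close>. The map \<open>z \<mapsto> lpow z 1\<close> is only a local chart: differentiability
  of \<open>\<lambda>a. lpow (\<phi> a) 1\<close> alone would allow \<open>\<phi>\<close> to jump between sheets.
\<close>
definition log_surface_smooth_at ::
    "(complex ^ 'd::finite \<Rightarrow> log_surface) \<Rightarrow> complex ^ 'd \<Rightarrow> bool" where
  "log_surface_smooth_at \<phi> a \<longleftrightarrow> (\<forall>w. partials_exist w (\<lambda>x. llog (\<phi> x)) a)"

end

theory Submission imports Defs begin

text \<open>
  In the chart \<^const>\<open>llog\<close> the function \<open>\<phi>\<close> becomes a root \<open>L a\<close> of the entire function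
  \<open>F a z = 1 + b exp (\<beta> z) + (\<Sum>i. a\<^sub>i exp (\<gamma>\<^sub>i z))\<close>. Around \<open>L 0\<close> there is a circle that encloses
  only this root for all small \<open>a\<close>, so \<open>exp (L a)\<close> is \<open>1 / (2 \<pi> \<i>)\<close> times the integral of
  \<open>exp z F' a z / F a z\<close> along a circle that does not depend on \<open>a\<close>. Differentiating under the integral
  and integrating by parts, one gets integrals \<open>J N C\<close> of \<open>exp (C z) / F a z ^ N\<close>, with
  \<open>\<partial>\<^sub>i (J N C) = - N J (N + 1) (C + \<gamma>\<^sub>i)\<close>. At \<open>a = 0\<close> we have \<open>F' = \<beta> (F - 1)\<close>, and a
  further integration by parts yields \<open>N \<beta> J (N + 1) C = (N \<beta> - C) J N C\<close>, whence the product.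

  The hypothesis on \<open>\<phi>\<close> only controls iterated partial derivatives, so \<open>L\<close> need not be
  continuous near \<open>0\<close>; the root stays inside the circle along the axis-parallel
  paths that the derivative in question explores, which is enough.
\<close>

subsection \<open>Iterated partial derivatives\<close>

text \<open>
  Each step of the path may be bounded in terms of the point reached so far, as in
  \<^const>\<open>partials_exist\<close>: this is weaker than holding on a neighbourhood of \<open>a\<close>.
\<close>
primrec axis_near :: "'d::finite list \<Rightarrow> (complex ^ 'd \<Rightarrow> bool) \<Rightarrow> complex ^ 'd \<Rightarrow> bool" where
  "axis_near [] P a \<longleftrightarrow> P a"
| "axis_near (i # w) P a \<longleftrightarrow> (\<forall>\<^sub>F t in nhds 0. axis_near w P (a + axis i t))"

lemma axis_near_mono:
  assumes "axis_near w P a" "\<And>x. P x \<Longrightarrow> Q x"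
  shows "axis_near w Q a"
  using assms(1) by (induction w arbitrary: a) (auto elim: eventually_mono simp: assms(2))

text \<open>A derivative sees only the germ of its function along one axis, so at each stage
  agreement for small \<open>t\<close> suffices; \<open>axis_near\<close> nests exactly these
  conditions.\<close>

lemma iter_partial_cong:
  assumes "axis_near w (\<lambda>x. F x = G x) a"
  shows "iter_partial w F a = iter_partial w G a"
  using assms
proof (induction w arbitrary: a)
  case (Cons i w)
  have "\<forall>\<^sub>F t in nhds 0. axis_near w (\<lambda>x. F x = G x) (a + axis i t)"
    using Cons.prems by simp
  then have "\<forall>\<^sub>F t in nhds 0. iter_partial w F (a + axis i t) = iter_partial w G (a + axis i t)"
    by eventually_elim (rule Cons.IH)
  then show ?case by (simp add: partial_deriv_def deriv_cong_ev)
qed simp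

lemma field_differentiable_cong_nhds:
  assumes "\<forall>\<^sub>F x in nhds a. f x = g x"
  shows "f field_differentiable at a \<longleftrightarrow> g field_differentiable at a"
  using DERIV_cong_ev[OF refl assms refl] by (simp add: field_differentiable_def)

lemma partials_exist_cong:
  assumes "axis_near w (\<lambda>x. F x = G x) a"
  shows "partials_exist w F a \<longleftrightarrow> partials_exist w G a"
  using assms
proof (induction w arbitrary: a)
  case (Cons i w)
  let ?E = "\<lambda>t. axis_near w (\<lambda>x. F x = G x) (a + axis i t)"
  have ev: "\<forall>\<^sub>F t in nhds 0. ?E t" using Cons.prems by simp
  have "(\<forall>\<^sub>F t in nhds 0. partials_exist w F (a + axis i t)) \<longleftrightarrow>
        (\<forall>\<^sub>F t in nhds 0. partials_exist w G (a + axis i t))"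
    by (rule eventually_cong[OF ev]) (rule Cons.IH)
  moreover have "\<forall>\<^sub>F t in nhds 0. iter_partial w F (a + axis i t) = iter_partial w G (a + axis i t)"
    using ev by eventually_elim (rule iter_partial_cong)
  ultimately show ?case by (simp add: field_differentiable_cong_nhds)
qed simp

lemma axis_zero [simp]: "axis i 0 = 0"
  by (simp add: axis_def vec_eq_iff)

lemma tendsto_add_axis: "((\<lambda>t. a + axis i t) \<longlongrightarrow> (a :: complex ^ 'd::finite)) (nhds 0)"
proof (rule vec_tendstoI)
  fix j
  have "((\<lambda>t. (a + axis i t) $ j) \<longlongrightarrow> (a + axis i 0) $ j) (nhds (0::complex))"
    by (cases "j = i") (auto simp: axis_def intro!: tendsto_eq_intros filterlim_ident)
  then show "((\<lambda>t. (a + axis i t) $ j) \<longlongrightarrow> a $ j) (nhds (0::complex))"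
    by simp
qed

lemma eventually_add_axis:
  assumes "open V" "a \<in> V"
  shows "\<forall>\<^sub>F t in nhds 0. (a :: complex ^ 'd::finite) + axis i t \<in> V"
  using tendsto_add_axis assms by (rule topological_tendstoD)

text \<open>Existence of a partial derivative gives continuity only along its own axis. The path
  moves first along the head \<open>i\<close>: the prefix \<open>[i]\<close> keeps \<open>F\<close>
  in \<open>B\<close> for small \<open>t\<close>, and the longer prefixes hand existence on to the
  point reached, from which the tail is followed.\<close>

lemma partials_exist_axis_near:
  assumes "\<And>k. k \<le> length w \<Longrightarrow> partials_exist (take k w) F a"
    and B: "open B" "F a \<in> B" and V: "open V" "a \<in> V"
  shows "axis_near w (\<lambda>x. F x \<in> B \<and> x \<in> V) a"
  using assms(1) B(2) V(2)
proof (induction w arbitrary: a)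
  case (Cons i w)
  have "\<forall>\<^sub>F t in nhds 0. \<forall>k\<in>{..length w}. partials_exist (take k w) F (a + axis i t)"
    using Cons.prems(1)[of "Suc _"] by (intro eventually_ball_finite) auto
  moreover have "\<forall>\<^sub>F t in nhds 0. a + axis i t \<in> V"
    using V(1) Cons.prems(3) by (rule eventually_add_axis)
  moreover have "\<forall>\<^sub>F t in nhds 0. F (a + axis i t) \<in> B"
  proof -
    have "(\<lambda>t. F (a + axis i t)) field_differentiable at 0"
      using Cons.prems(1)[of 1] by simp
    then have "isCont (\<lambda>t. F (a + axis i t)) 0"
      by (rule field_differentiable_imp_continuous_at)
    then have "((\<lambda>t. F (a + axis i t)) \<longlongrightarrow> F a) (nhds 0)"
      by (simp add: isCont_def tendsto_nhds_iff)
    then show ?thesis using B(1) Cons.prems(2) by (rule topological_tendstoD)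
  qed
  ultimately show ?case
    by (simp, eventually_elim) (auto intro: Cons.IH)
qed simp

text \<open>Lets a list-indexed family \<open>D\<close> of candidate derivatives be verified one
  differentiation at a time. Since \<open>V\<close> is open, the formula for a shorter list holds at
  all nearby points and can be differentiated again.\<close>

lemma iter_partial_eqI:
  assumes V: "open V" "a \<in> V"
    and deriv: "\<And>w i a. a \<in> V \<Longrightarrow> ((\<lambda>t. D w (a + axis i t)) has_field_derivative D (i # w) a) (at 0)"
  shows "partials_exist w (D []) a \<and> iter_partial w (D []) a = D w a"
  using V(2)
proof (induction w arbitrary: a)
  case (Cons i w)
  have ev: "\<forall>\<^sub>F t in nhds 0. a + axis i t \<in> V"
    using V(1) Cons.prems by (rule eventually_add_axis)
  have "\<forall>\<^sub>F t in nhds 0. partials_exist w (D []) (a + axis i t)"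
    using ev by eventually_elim (simp add: Cons.IH)
  moreover have eq: "\<forall>\<^sub>F t in nhds 0. iter_partial w (D []) (a + axis i t) = D w (a + axis i t)"
    using ev by eventually_elim (simp add: Cons.IH)
  have "((\<lambda>t. iter_partial w (D []) (a + axis i t)) has_field_derivative D (i # w) a) (at 0)"
    unfolding DERIV_cong_ev[OF refl eq refl] by (rule deriv[OF Cons.prems])
  ultimately show ?case
    by (auto simp: partial_deriv_def field_differentiable_def DERIV_imp_deriv)
qed simp

subsection \<open>Preliminaries on holomorphic functions\<close>

text \<open>The quotient \<open>q\<close> of \<open>f\<close> by \<open>z - p\<close>, continued by
  \<open>f' p\<close> at \<open>p\<close>, has no zeros on \<open>S\<close>. The integrand is then
  \<open>h * f' / q\<close> divided by \<open>z - p\<close>, and Cauchy's formula yields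
  \<open>h p\<close> because \<open>q p = f' p\<close>.\<close>

lemma residue_simple_zero_circlepath:
  fixes f :: "complex \<Rightarrow> complex"
  assumes S: "open S" "cball c r \<subseteq> S"
    and deriv: "\<And>z. z \<in> S \<Longrightarrow> (f has_field_derivative f' z) (at z)"
    and h: "h holomorphic_on S"
    and p: "p \<in> ball c r" "f p = 0" "f' p \<noteq> 0"
    and uniq: "\<And>z. z \<in> S \<Longrightarrow> f z = 0 \<Longrightarrow> z = p"
  shows "((\<lambda>z. h z * f' z / f z) has_contour_integral (2 * of_real pi * \<i>) * h p) (circlepath c r)"
proof -
  have pS: "p \<in> S" using p(1) S(2) by (meson ball_subset_cball subsetD)
  have f_holo: "f holomorphic_on S"
    using deriv S(1) by (metis holomorphic_on_open)
  have f'_eq: "f' z = deriv f z" if "z \<in> S" for z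
    using deriv[OF that] by (simp add: DERIV_imp_deriv)
  define q where "q z = (if z = p then f' p else f z / (z - p))" for z
  have q_holo: "q holomorphic_on S"
    by (rule pole_theorem_open_0[OF f_holo S(1), where a = p])
       (use f'_eq[OF pS] p in \<open>auto simp: q_def\<close>)
  have q_nz: "q z \<noteq> 0" if "z \<in> S" for z
    using uniq[OF that] p(3) by (auto simp: q_def)
  define G where "G z = h z * deriv f z / q z" for z
  have G: "G holomorphic_on S"
    unfolding G_def using q_nz by (intro holomorphic_intros h q_holo f_holo S(1)) auto
  have "((\<lambda>z. G z / (z - p)) has_contour_integral (2 * of_real pi * \<i>) * G p) (circlepath c r)"
    by (rule Cauchy_integral_circlepath)
       (use p(1) holomorphic_on_subset[OF G S(2)] holomorphic_on_subset[OF G order_trans[OF ball_subset_cball S(2)]]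
        in \<open>auto intro!: holomorphic_on_imp_continuous_on simp: dist_norm norm_minus_commute\<close>)
  moreover have "G p = h p" using p f'_eq[OF pS] by (simp add: G_def q_def)
  moreover have "G z / (z - p) = h z * f' z / f z" if "z \<in> path_image (circlepath c r)" for z
  proof -
    have "r > 0" using p(1) by (metis ball_eq_empty empty_iff not_less)
    then have "z \<in> sphere c r" using that by (simp add: path_image_circlepath_nonneg)
    then have "z \<in> S" "z \<noteq> p" using S(2) p(1) by (auto simp: subset_iff)
    then show ?thesis using uniq[of z] by (auto simp: G_def q_def f'_eq)
  qed
  ultimately show ?thesis by (metis (no_types, lifting) has_contour_integral_eq)
qed

text \<open>Subtracting \<open>k * x\<close> leaves a map with Lipschitz constant
  \<open>norm k / 2\<close>, while \<open>k * x\<close> itself stretches distances by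
  \<open>norm k\<close>. The bound serves both to make a root unique in a disc and to exclude zeros
  on a circle.\<close>

lemma nearly_linear_lower_bound:
  fixes f :: "complex \<Rightarrow> complex"
  assumes "convex S" and deriv: "\<And>z. z \<in> S \<Longrightarrow> (f has_field_derivative f' z) (at z)"
    and bound: "\<And>z. z \<in> S \<Longrightarrow> norm (f' z - k) \<le> norm k / 2"
    and "x \<in> S" "y \<in> S"
  shows "norm k / 2 * norm (x - y) \<le> norm (f x - f y)"
proof -
  have "norm ((f x - k * x) - (f y - k * y)) \<le> norm k / 2 * norm (x - y)"
  proof (rule field_differentiable_bound[OF \<open>convex S\<close> _ bound])
    fix z assume "z \<in> S"
    show "((\<lambda>x. f x - k * x) has_field_derivative f' z - k) (at z within S)"
      using has_field_derivative_at_within[OF deriv[OF \<open>z \<in> S\<close>], of S]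
      by (auto intro!: derivative_eq_intros)
  qed (use assms in auto)
  moreover have "norm (k * (x - y)) \<le> norm (f x - f y) + norm ((f x - k * x) - (f y - k * y))"
    by (rule order_trans[OF _ norm_triangle_ineq4]) (simp add: algebra_simps)
  ultimately show ?thesis by (simp add: norm_mult)
qed

lemma has_field_derivative_divide_power:
  fixes f g :: "complex \<Rightarrow> complex"
  assumes f: "(f has_field_derivative f') (at z within S)"
    and g: "(g has_field_derivative g') (at z within S)" and nz: "f z \<noteq> 0"
  shows "((\<lambda>z. g z / f z ^ N) has_field_derivative
    g' / f z ^ N - of_nat N * (g z * f' / f z ^ Suc N)) (at z within S)"
proof -
  have "((\<lambda>z. g z * inverse (f z) ^ N) has_field_derivative
      g' * inverse (f z) ^ N + of_nat N * (- (inverse (f z) * f' * inverse (f z)) * inverse (f z) ^ (N - Suc 0)) * g z)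
      (at z within S)"
    using DERIV_mult[OF g DERIV_power[OF DERIV_inverse'[OF f nz]]] by simp
  \<comment> \<open>For \<open>N = 0\<close> the factor \<open>of_nat N\<close> removes the term
    with the truncated exponent.\<close>
  then show ?thesis
    by (cases N) (simp_all add: divide_inverse power_inverse mult_ac)
qed

subsection \<open>Contour integrals of the perturbed binomial\<close>

locale perturbed_binomial =
  fixes b \<beta> :: complex and \<gamma> :: "complex ^ 'd::finite"
begin

definition F :: "complex ^ 'd \<Rightarrow> complex \<Rightarrow> complex" where
  "F a z = 1 + b * exp (\<beta> * z) + (\<Sum>i\<in>UNIV. a $ i * exp (\<gamma> $ i * z))"

definition F' :: "complex ^ 'd \<Rightarrow> complex \<Rightarrow> complex" where
  "F' a z = b * \<beta> * exp (\<beta> * z) + (\<Sum>i\<in>UNIV. a $ i * \<gamma> $ i * exp (\<gamma> $ i * z))"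

lemma F_deriv: "(F a has_field_derivative F' a z) (at z)"
  unfolding F_def F'_def
  by (auto intro!: derivative_eq_intros sum.cong simp: algebra_simps)

lemma continuous_on_F [continuous_intros]:
  assumes "continuous_on S f" "continuous_on S g"
  shows "continuous_on S (\<lambda>x. F (f x) (g x))"
  unfolding F_def by (intro continuous_intros assms)

lemma continuous_on_F' [continuous_intros]:
  assumes "continuous_on S f" "continuous_on S g"
  shows "continuous_on S (\<lambda>x. F' (f x) (g x))"
  unfolding F'_def by (intro continuous_intros assms)

lemma F_axis: "F (a + axis i t) z = F a z + t * exp (\<gamma> $ i * z)"
proof -
  have "(\<Sum>j\<in>UNIV. axis i t $ j * exp (\<gamma> $ j * z)) = (\<Sum>j\<in>UNIV. if j = i then t * exp (\<gamma> $ j * z) else 0)"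
    by (rule sum.cong) (auto simp: axis_def)
  then show ?thesis
    by (simp add: F_def distrib_right sum.distrib)
qed

section \<open>Recurrences between the contour integrals\<close>

definition J :: "complex \<Rightarrow> real \<Rightarrow> nat \<Rightarrow> complex \<Rightarrow> complex ^ 'd \<Rightarrow> complex" where
  "J c r N C a = contour_integral (circlepath c r) (\<lambda>z. exp (C * z) / F a z ^ N)"

text \<open>This is the integral of \<open>exp (C * z) * F' a z / F a z ^ N\<close>, expanded over
  the terms of \<open>F'\<close> so that its derivatives in \<open>a\<close> reduce to those of
  \<open>J\<close>.\<close>

definition M :: "complex \<Rightarrow> real \<Rightarrow> nat \<Rightarrow> complex \<Rightarrow> complex ^ 'd \<Rightarrow> complex" where
  "M c r N C a = b * \<beta> * J c r N (C + \<beta>) a + (\<Sum>i\<in>UNIV. a $ i * \<gamma> $ i * J c r N (C + \<gamma> $ i) a)"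

context
  fixes c :: complex and r :: real
  assumes r: "r \<ge> 0"
begin

lemma J_has_integral:
  assumes "\<And>z. z \<in> sphere c r \<Longrightarrow> F a z \<noteq> 0"
  shows "((\<lambda>z. exp (C * z) / F a z ^ N) has_contour_integral J c r N C a) (circlepath c r)"
  unfolding J_def using r assms
  by (intro has_contour_integral_integral contour_integrable_continuous_circlepath continuous_intros) auto

lemma M_has_integral:
  assumes nz: "\<And>z. z \<in> sphere c r \<Longrightarrow> F a z \<noteq> 0"
  shows "((\<lambda>z. exp (C * z) * F' a z / F a z ^ N) has_contour_integral M c r N C a) (circlepath c r)"
proof -
  have "((\<lambda>z. b * \<beta> * (exp ((C + \<beta>) * z) / F a z ^ N) +
      (\<Sum>i\<in>UNIV. a $ i * \<gamma> $ i * (exp ((C + \<gamma> $ i) * z) / F a z ^ N)))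
      has_contour_integral M c r N C a) (circlepath c r)"
    unfolding M_def
    by (intro has_contour_integral_add has_contour_integral_lmul has_contour_integral_sum
        J_has_integral nz) auto
  then show ?thesis
    by (rule has_contour_integral_eq)
       (simp add: F'_def exp_add algebra_simps sum_distrib_left add_divide_distrib sum_divide_distrib)
qed

text \<open>The derivative of \<open>exp (C * z) / F a z ^ N\<close> integrates to zero around the
  circle. A primitive on the circle itself is enough, so zeros of \<open>F a\<close> inside do no
  harm.\<close>

lemma J_by_parts:
  assumes nz: "\<And>z. z \<in> sphere c r \<Longrightarrow> F a z \<noteq> 0"
  shows "C * J c r N C a = of_nat N * M c r (Suc N) C a"
proof -
  let ?f = "\<lambda>z. C * (exp (C * z) / F a z ^ N) - of_nat N * (exp (C * z) * F' a z / F a z ^ Suc N)"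
  have D: "((\<lambda>z. exp (C * z) / F a z ^ N) has_field_derivative ?f z) (at z within sphere c r)"
    if z: "z \<in> sphere c r" for z
  proof -
    have "((\<lambda>z. exp (C * z)) has_field_derivative C * exp (C * z)) (at z within sphere c r)"
      by (auto intro!: derivative_eq_intros)
    from has_field_derivative_divide_power[OF has_field_derivative_at_within[OF F_deriv] this nz[OF z], of N]
    show ?thesis by simp
  qed
  have int0: "(?f has_contour_integral 0) (circlepath c r)"
    by (rule Cauchy_theorem_primitive[OF D]) (use r in simp_all)
  have "(?f has_contour_integral C * J c r N C a - of_nat N * M c r (Suc N) C a) (circlepath c r)"
    by (intro has_contour_integral_diff has_contour_integral_lmul J_has_integral M_has_integral nz)
  from has_contour_integral_unique[OF this int0] show ?thesis by simp
qed

text \<open>Replacing \<open>F'\<close> by \<open>\<beta> * (F - 1)\<close> splits the integrand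
  into two of the kind found in \<open>J\<close>, with adjacent powers.\<close>

lemma M_at_0:
  assumes nz: "\<And>z. z \<in> sphere c r \<Longrightarrow> F 0 z \<noteq> 0"
  shows "M c r (Suc N) C 0 = \<beta> * (J c r N C 0 - J c r (Suc N) C 0)"
proof -
  have "((\<lambda>z. \<beta> * (exp (C * z) / F 0 z ^ N - exp (C * z) / F 0 z ^ Suc N))
      has_contour_integral \<beta> * (J c r N C 0 - J c r (Suc N) C 0)) (circlepath c r)"
    by (intro has_contour_integral_diff has_contour_integral_lmul J_has_integral nz)
  moreover have "\<beta> * (exp (C * z) / F 0 z ^ N - exp (C * z) / F 0 z ^ Suc N) =
      exp (C * z) * F' 0 z / F 0 z ^ Suc N" if "z \<in> path_image (circlepath c r)" for z
  proof -
    have "F 0 z \<noteq> 0" using that nz r by auto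
    moreover have "F' 0 z = \<beta> * (F 0 z - 1)" by (simp add: F_def F'_def)
    ultimately show ?thesis by (simp add: divide_simps) (simp add: algebra_simps)
  qed
  ultimately have "((\<lambda>z. exp (C * z) * F' 0 z / F 0 z ^ Suc N)
      has_contour_integral \<beta> * (J c r N C 0 - J c r (Suc N) C 0)) (circlepath c r)"
    by (rule has_contour_integral_eq)
  with M_has_integral[OF nz] show ?thesis
    by (rule has_contour_integral_unique)
qed

lemma J_at_0_Suc:
  assumes nz: "\<And>z. z \<in> sphere c r \<Longrightarrow> F 0 z \<noteq> 0"
  shows "of_nat N * \<beta> * J c r (Suc N) C 0 = (of_nat N * \<beta> - C) * J c r N C 0"
proof -
  have "C * J c r N C 0 = of_nat N * (\<beta> * (J c r N C 0 - J c r (Suc N) C 0))"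
    using J_by_parts[OF nz, of C N] M_at_0[OF nz, of N C] by simp
  then show ?thesis by (simp add: algebra_simps)
qed

text \<open>For \<open>N = 0\<close> the left side of \<open>J_at_0_Suc\<close> vanishes, which says
  nothing about \<open>J c r 1\<close>. The start of the recurrence comes instead from
  \<open>J c r 0\<close>, the integral of an entire function, being zero.\<close>

lemma J_at_0_1:
  assumes nz: "\<And>z. z \<in> sphere c r \<Longrightarrow> F 0 z \<noteq> 0"
  shows "\<beta> * J c r 1 C 0 = - M c r 1 C 0"
proof -
  have "((\<lambda>z. exp (C * z)) has_contour_integral 0) (circlepath c r)"
    by (rule Cauchy_theorem_convex_simple[where S = UNIV]) (auto intro!: holomorphic_intros)
  then have "J c r 0 C 0 = 0"
    by (simp add: J_def contour_integral_unique)
  then show ?thesis using M_at_0[OF nz, of 0 C] by simp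
qed

lemma J_at_0_closed_form:
  assumes nz: "\<And>z. z \<in> sphere c r \<Longrightarrow> F 0 z \<noteq> 0"
  shows "fact N * \<beta> ^ Suc N * J c r (Suc N) C 0 = - M c r 1 C 0 * (\<Prod>j = 1..N. of_nat j * \<beta> - C)"
proof (induction N)
  case 0
  then show ?case using J_at_0_1[OF nz, of C] by simp
next
  case (Suc N)
  have "fact (Suc N) * \<beta> ^ Suc (Suc N) * J c r (Suc (Suc N)) C 0 =
      fact N * \<beta> ^ Suc N * (of_nat (Suc N) * \<beta> * J c r (Suc (Suc N)) C 0)"
    by (simp add: algebra_simps)
  also have "\<dots> = fact N * \<beta> ^ Suc N * J c r (Suc N) C 0 * (of_nat (Suc N) * \<beta> - C)"
    by (subst J_at_0_Suc[OF nz]) (simp_all add: algebra_simps)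
  also have "\<dots> = - M c r 1 C 0 * (\<Prod>j = 1..Suc N. of_nat j * \<beta> - C)"
    by (subst Suc.IH) (simp add: algebra_simps)
  finally show ?case .
qed

section \<open>Differentiating the contour integrals in the coefficients\<close>

lemma J_deriv:
  assumes V: "open V" "a \<in> V" and nz: "\<And>x z. x \<in> V \<Longrightarrow> z \<in> sphere c r \<Longrightarrow> F x z \<noteq> 0"
  shows "((\<lambda>t. J c r N C (a + axis i t)) has_field_derivative
    - of_nat N * J c r (Suc N) (C + \<gamma> $ i) a) (at 0)"
proof -
  obtain e where e: "e > 0" "\<And>t. t \<in> ball 0 e \<Longrightarrow> a + axis i t \<in> V"
    using eventually_add_axis[OF V, of i] by (auto simp: eventually_nhds_metric dist_commute)
  let ?p = "circlepath c r"
  \<comment> \<open>\<open>?d\<close> is the velocity of the circle; it turns the contour integral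
    into one over \<open>[0, 1]\<close>, to which the Leibniz rule applies.\<close>
  let ?d = "\<lambda>s. of_real (2 * pi) * \<i> * of_real r * exp (2 * of_real pi * \<i> * of_real s)"
  have p: "?p s \<in> sphere c r" if "s \<in> {0..1}" for s
    using that r path_image_circlepath_nonneg[OF r, of c] by (auto simp: path_image_def)
  have cp: "continuous_on A (\<lambda>x. ?p (f x))" if "continuous_on A f" for A and f :: "complex \<times> real \<Rightarrow> real"
    unfolding circlepath by (intro continuous_intros that)
  have cp1: "continuous_on A ?p" for A
    unfolding circlepath by (intro continuous_intros)
  have nz': "F a (?p s) + t * exp (\<gamma> $ i * ?p s) \<noteq> 0" if "t \<in> ball 0 e" "s \<in> {0..1}" for t s
    using nz[OF e(2) p] that by (simp add: F_axis)
  \<comment> \<open>By \<open>F_axis\<close> the base of the denominator is affine in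
    \<open>t\<close>. Its slope is an exponential, which shifts \<open>C\<close> to
    \<open>C + \<gamma> $ i\<close>.\<close>
  let ?f = "\<lambda>t s. exp (C * ?p s) / (F a (?p s) + t * exp (\<gamma> $ i * ?p s)) ^ N * ?d s"
  let ?f' = "\<lambda>t s. - of_nat N * (exp ((C + \<gamma> $ i) * ?p s) / (F a (?p s) + t * exp (\<gamma> $ i * ?p s)) ^ Suc N) * ?d s"
  have "((\<lambda>t. integral (cbox 0 1) (?f t)) has_field_derivative integral (cbox 0 1) (?f' 0))
      (at 0 within ball 0 e)"
  proof (rule leibniz_rule_field_derivative)
    fix t s assume ts: "t \<in> ball (0::complex) e" "s \<in> cbox (0::real) 1"
    have "((\<lambda>t. exp (C * ?p s) / (F a (?p s) + t * exp (\<gamma> $ i * ?p s)) ^ N) has_field_derivative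
        - of_nat N * (exp ((C + \<gamma> $ i) * ?p s) / (F a (?p s) + t * exp (\<gamma> $ i * ?p s)) ^ Suc N))
        (at t within ball 0 e)"
    proof -
      have "((\<lambda>t. F a (?p s) + t * exp (\<gamma> $ i * ?p s)) has_field_derivative exp (\<gamma> $ i * ?p s))
          (at t within ball 0 e)"
        by (auto intro!: derivative_eq_intros)
      from has_field_derivative_divide_power[OF this DERIV_const, of "exp (C * ?p s)" N] nz'[of t s] ts
      show ?thesis by (simp add: exp_add distrib_right)
    qed
    then show "((\<lambda>t. ?f t s) has_field_derivative ?f' t s) (at t within ball 0 e)"
      by (rule DERIV_cmult_right)
  next
    fix t assume t: "t \<in> ball (0::complex) e"
    show "?f t integrable_on cbox 0 1"
      by (intro integrable_continuous continuous_intros cp1 ballI power_not_zero nz'[OF t]) simp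
  next
    have "F a (?p (snd x)) + fst x * exp (\<gamma> $ i * ?p (snd x)) \<noteq> 0" if "x \<in> ball 0 e \<times> cbox 0 1" for x
      by (rule nz') (use that in \<open>simp_all add: mem_Times_iff\<close>)
    then show "continuous_on (ball 0 e \<times> cbox 0 1) (\<lambda>(t, s). ?f' t s)"
      unfolding split_def by (intro continuous_intros cp ballI power_not_zero) blast
  qed (use e(1) in simp_all)
  then have "((\<lambda>t. integral (cbox 0 1) (?f t)) has_field_derivative integral (cbox 0 1) (?f' 0)) (at 0)"
    by (simp only: at_within_open[OF _ open_ball] centre_in_ball e(1))
  moreover have "integral (cbox 0 1) (?f t) = J c r N C (a + axis i t)" for t
    by (simp only: J_def contour_integral_integral F_axis vector_derivative_circlepath interval_cbox)
  moreover have "integral (cbox 0 1) (?f' 0) = - of_nat N * J c r (Suc N) (C + \<gamma> $ i) a"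
  proof -
    have "?f' 0 = (\<lambda>s. - of_nat N * (exp ((C + \<gamma> $ i) * ?p s) / F a (?p s) ^ Suc N * ?d s))"
      by (rule ext) (simp only: mult_zero_left add_0_right mult.assoc)
    then show ?thesis
      by (simp only: J_def contour_integral_integral vector_derivative_circlepath
          integral_mult_right interval_cbox)
  qed
  ultimately show ?thesis by simp
qed

end

text \<open>The explicit coefficient \<open>a $ i\<close> contributes \<open>\<gamma> $ i\<close>
  times \<open>J\<close> of power 1, and the other terms assemble to \<open>- M\<close> of power 2,
  both at exponent \<open>C + \<gamma> $ i\<close>. Integration by parts turns the latter into
  \<open>- (C + \<gamma> $ i)\<close> times the same \<open>J\<close>, so only the factor
  \<open>- C\<close> survives.\<close>

lemma M_deriv:
  assumes r: "r \<ge> 0" and V: "open V" "a \<in> V"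
    and nz: "\<And>x z. x \<in> V \<Longrightarrow> z \<in> sphere c r \<Longrightarrow> F x z \<noteq> 0"
  shows "((\<lambda>t. M c r 1 C (a + axis i t)) has_field_derivative - C * J c r 1 (C + \<gamma> $ i) a) (at 0)"
proof -
  have J': "((\<lambda>t. J c r 1 C (a + axis i t)) has_field_derivative - J c r 2 (C + \<gamma> $ i) a) (at 0)" for C
    using J_deriv[OF r V nz, of c 1 C i] by (simp add: numeral_2_eq_2)
  have ax: "((\<lambda>t. (a + axis i t) $ j) has_field_derivative (if j = i then 1 else 0)) (at 0)" for j
    by (cases "j = i") (auto simp: axis_def intro!: derivative_eq_intros)
  have "((\<lambda>t. M c r 1 C (a + axis i t)) has_field_derivative
      b * \<beta> * - J c r 2 (C + \<beta> + \<gamma> $ i) a +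
      (\<Sum>j\<in>UNIV. ((if j = i then 1 else 0) * \<gamma> $ j) * J c r 1 (C + \<gamma> $ j) (a + axis i 0) +
         - J c r 2 (C + \<gamma> $ j + \<gamma> $ i) a * ((a + axis i 0) $ j * \<gamma> $ j))) (at 0)"
    unfolding M_def by (intro DERIV_add DERIV_cmult DERIV_sum DERIV_mult DERIV_cmult_right J' ax)
  also have "(\<Sum>j\<in>UNIV. ((if j = i then 1 else 0) * \<gamma> $ j) * J c r 1 (C + \<gamma> $ j) (a + axis i 0) +
         - J c r 2 (C + \<gamma> $ j + \<gamma> $ i) a * ((a + axis i 0) $ j * \<gamma> $ j)) =
      (\<Sum>j\<in>UNIV. (if j = i then \<gamma> $ i * J c r 1 (C + \<gamma> $ i) a else 0)) -
      (\<Sum>j\<in>UNIV. a $ j * \<gamma> $ j * J c r 2 (C + \<gamma> $ i + \<gamma> $ j) a)"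
    unfolding sum_subtractf[symmetric] by (rule sum.cong) (auto simp: algebra_simps)
  also have "b * \<beta> * - J c r 2 (C + \<beta> + \<gamma> $ i) a + \<dots> =
      \<gamma> $ i * J c r 1 (C + \<gamma> $ i) a - M c r 2 (C + \<gamma> $ i) a"
    by (simp add: M_def algebra_simps)
  also have "M c r 2 (C + \<gamma> $ i) a = (C + \<gamma> $ i) * J c r 1 (C + \<gamma> $ i) a"
    using J_by_parts[OF r nz[OF V(2)], of c "C + \<gamma> $ i" 1] by (simp add: numeral_2_eq_2)
  finally show ?thesis by (simp add: algebra_simps)
qed

text \<open>The first derivative replaces \<open>M\<close> by \<open>- J\<close> of power 1. Each
  further one multiplies by minus the current power, raises that power and adds some
  \<open>\<gamma> $ i\<close> to the exponent, which produces the sign and the factorial.\<close>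

lemma iterated_contour_integral:
  assumes r: "r \<ge> 0" and V: "open V" "a \<in> V"
    and nz: "\<And>x z. x \<in> V \<Longrightarrow> z \<in> sphere c r \<Longrightarrow> F x z \<noteq> 0"
    and w: "w \<noteq> []"
  defines "H \<equiv> \<lambda>a. M c r 1 1 a / (2 * of_real pi * \<i>)"
  shows "partials_exist w H a \<and> iter_partial w H a =
    (- 1) ^ length w * fact (length w - 1) * J c r (length w) (1 + (\<Sum>i\<leftarrow>w. \<gamma> $ i)) a / (2 * of_real pi * \<i>)"
proof -
  \<comment> \<open>The factorial lags one behind the length because the passage from
    \<open>M\<close> to \<open>J\<close> contributes only a sign when \<open>C = 1\<close>.\<close>
  define D where "D v a = (if v = [] then M c r 1 1 a else
      (- 1) ^ length v * fact (length v - 1) * J c r (length v) (1 + (\<Sum>i\<leftarrow>v. \<gamma> $ i)) a) /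
      (2 * of_real pi * \<i>)" for v a
  have "partials_exist w (D []) a \<and> iter_partial w (D []) a = D w a"
  proof (rule iter_partial_eqI[OF V])
    fix v i x assume x: "x \<in> V"
    show "((\<lambda>t. D v (x + axis i t)) has_field_derivative D (i # v) x) (at 0)"
    proof (cases v)
      case Nil
      then show ?thesis
        using DERIV_cdivide[OF M_deriv[OF r V(1) x nz, of c 1 i]] by (simp add: D_def)
    next
      case (Cons j u)
      let ?s = "1 + (\<Sum>i\<leftarrow>v. \<gamma> $ i)"
      have "((\<lambda>t. (- 1) ^ length v * fact (length v - 1) * J c r (length v) ?s (x + axis i t) / (2 * of_real pi * \<i>))
          has_field_derivative (- 1) ^ length v * fact (length v - 1) *
            (- of_nat (length v) * J c r (Suc (length v)) (?s + \<gamma> $ i) x) / (2 * of_real pi * \<i>)) (at 0)"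
        by (intro DERIV_cdivide DERIV_cmult J_deriv[OF r V(1) x nz])
      then show ?thesis using Cons by (simp add: D_def algebra_simps)
    qed
  qed
  moreover have "D [] = H" by (simp add: D_def H_def fun_eq_iff)
  ultimately show ?thesis using w by (simp add: D_def)
qed

section \<open>Localising the root\<close>

text \<open>With \<open>F' a\<close> close to \<open>k\<close> on the larger disc,
  \<open>F a\<close> is injective there, so \<open>p\<close> is its only zero and simple, and the
  integral is a residue.\<close>

lemma exp_zero_contour_integral:
  assumes r: "r > 0" "r < R"
    and nz: "\<And>z. z \<in> sphere c r \<Longrightarrow> F a z \<noteq> 0"
    and k: "k \<noteq> 0" and bound: "\<And>z. z \<in> ball c R \<Longrightarrow> norm (F' a z - k) \<le> norm k / 2"
    and p: "p \<in> ball c r" "F a p = 0"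
  shows "M c r 1 C a = 2 * of_real pi * \<i> * exp (C * p)"
proof -
  have pR: "p \<in> ball c R" using p(1) r(2) by auto
  have "((\<lambda>z. exp (C * z) * F' a z / F a z) has_contour_integral (2 * of_real pi * \<i>) * exp (C * p))
      (circlepath c r)"
  proof (rule residue_simple_zero_circlepath[where S = "ball c R" and p = p])
    show "F' a p \<noteq> 0" using bound[OF pR] k by auto
    show "z = p" if "z \<in> ball c R" "F a z = 0" for z
      using nearly_linear_lower_bound[OF convex_ball F_deriv bound that(1) pR] k that(2) p(2)
      by (simp add: mult_le_0_iff)
  qed (use r p F_deriv in \<open>auto intro!: holomorphic_intros\<close>)
  moreover have "((\<lambda>z. exp (C * z) * F' a z / F a z) has_contour_integral M c r 1 C a) (circlepath c r)"
    using M_has_integral[OF _ nz, where N = 1 and C = C] r(1) by simp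
  ultimately show ?thesis using has_contour_integral_unique by blast
qed

text \<open>At the root \<open>F' 0 p\<close> equals \<open>- \<beta>\<close>, which is non-zero. By
  joint continuity \<open>F'\<close> stays close to it for \<open>a\<close> near \<open>0\<close>
  and \<open>z\<close> near \<open>p\<close>.\<close>

lemma isolating_disc:
  assumes p: "F 0 p = 0" and \<beta>: "\<beta> \<noteq> 0"
  obtains r R V where "0 < r" "r < R" "open V" "0 \<in> V"
    "\<And>a z. a \<in> V \<Longrightarrow> z \<in> ball p R \<Longrightarrow> norm (F' a z - (- \<beta>)) \<le> norm (- \<beta>) / 2"
    "\<And>a z. a \<in> V \<Longrightarrow> z \<in> sphere p r \<Longrightarrow> F a z \<noteq> 0"
proof -
  have F'0: "F' 0 p = - \<beta>"
  proof -
    have "F' 0 p = \<beta> * (F 0 p - 1)" by (simp add: F_def F'_def)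
    then show ?thesis by (simp add: p)
  qed
  have "continuous_on UNIV (\<lambda>x. norm (F' (fst x) (snd x) - (- \<beta>)))"
    by (intro continuous_intros)
  then have "open {x. norm (F' (fst x) (snd x) - (- \<beta>)) < norm \<beta> / 2}"
    by (rule open_Collect_less) (rule continuous_on_const)
  moreover have "(0, p) \<in> {x. norm (F' (fst x) (snd x) - (- \<beta>)) < norm \<beta> / 2}"
    using F'0 \<beta> by simp
  ultimately obtain A B where AB: "open A" "open B" "0 \<in> A" "p \<in> B"
      "A \<times> B \<subseteq> {x. norm (F' (fst x) (snd x) - (- \<beta>)) < norm \<beta> / 2}"
    by (rule open_prod_elim) (simp add: mem_Times_iff)
  obtain R where R: "R > 0" "ball p R \<subseteq> B" using AB(2,4) openE by blast
  define r where "r = R / 2"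
  \<comment> \<open>On the circle \<open>F a z\<close> differs from \<open>F a p\<close> by at least
    \<open>norm \<beta> / 2 * r\<close>; keeping \<open>F a p\<close> below this bound rules out
    zeros there.\<close>
  define V where "V = A \<inter> {a. norm (F a p) < norm \<beta> / 2 * r}"
  have r: "0 < r" "r < R" using R(1) by (auto simp: r_def)
  have "open V"
    unfolding V_def by (intro open_Int AB(1) open_Collect_less continuous_intros)
  moreover have "0 \<in> V"
    using AB(3) \<beta> r(1) by (simp add: V_def p)
  moreover have bound: "norm (F' a z - (- \<beta>)) \<le> norm (- \<beta>) / 2" if "a \<in> V" "z \<in> ball p R" for a z
  proof -
    have "(a, z) \<in> A \<times> B" using that R(2) by (auto simp: V_def)
    then show ?thesis using AB(5) by force
  qed
  moreover have "F a z \<noteq> 0" if a: "a \<in> V" and z: "z \<in> sphere p r" for a z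
  proof
    assume F0: "F a z = 0"
    have "z \<in> ball p R" "p \<in> ball p R" using z r by auto
    from nearly_linear_lower_bound[OF convex_ball F_deriv bound[OF a] this]
    have "norm \<beta> / 2 * r \<le> norm (F a p)"
      using z F0 by (simp add: dist_norm norm_minus_commute)
    then show False using a by (simp add: V_def)
  qed
  ultimately show thesis using r that by blast
qed

lemma iterated_partial_exp_root:
  assumes \<beta>: "\<beta> \<noteq> 0" and U: "open U" "0 \<in> U"
    and smooth: "\<And>w. partials_exist w L 0"
    and root: "\<And>a. a \<in> U \<Longrightarrow> F a (L a) = 0" and w: "w \<noteq> []"
  defines "N \<equiv> length w" and "C \<equiv> 1 + (\<Sum>i\<leftarrow>w. \<gamma> $ i)"
  shows "partials_exist w (\<lambda>a. exp (L a)) 0 \<and>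
    iter_partial w (\<lambda>a. exp (L a)) 0 =
      - (exp (C * L 0) / (- \<beta>) ^ N) * (\<Prod>j = 1..N - 1. of_nat j * \<beta> - C)"
proof -
  obtain r R V where rR: "0 < r" "r < R" and V: "open V" "0 \<in> V"
    and bound: "\<And>a z. a \<in> V \<Longrightarrow> z \<in> ball (L 0) R \<Longrightarrow> norm (F' a z - (- \<beta>)) \<le> norm (- \<beta>) / 2"
    and nz: "\<And>a z. a \<in> V \<Longrightarrow> z \<in> sphere (L 0) r \<Longrightarrow> F a z \<noteq> 0"
    using isolating_disc[OF root[OF U(2)] \<beta>] by metis
  define H where "H a = M (L 0) r 1 1 a / (2 * of_real pi * \<i>)" for a
  have "axis_near w (\<lambda>a. L a \<in> ball (L 0) r \<and> a \<in> V \<inter> U) 0"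
    by (rule partials_exist_axis_near) (use smooth V U rR in auto)
  \<comment> \<open>Wherever \<open>L a\<close> lies inside the disc, the residue formula with
    \<open>C = 1\<close> identifies \<open>exp (L a)\<close> with \<open>H a\<close>.\<close>
  then have near: "axis_near w (\<lambda>a. exp (L a) = H a) 0"
  proof (rule axis_near_mono)
    fix a assume "L a \<in> ball (L 0) r \<and> a \<in> V \<inter> U"
    then show "exp (L a) = H a"
      using exp_zero_contour_integral[OF rR nz _ bound, where p = "L a" and C = 1] \<beta> root[of a]
      by (simp add: H_def)
  qed
  have N: "N = Suc (N - 1)" using w by (simp add: N_def)
  have H: "partials_exist w H 0 \<and> iter_partial w H 0 =
      (- 1) ^ N * fact (N - 1) * J (L 0) r N C 0 / (2 * of_real pi * \<i>)"
    unfolding H_def N_def C_def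
    by (rule iterated_contour_integral[OF _ V nz w]) (use rR in auto)
  \<comment> \<open>After all differentiations the exponent is \<open>C\<close> instead of
    \<open>1\<close>; the residue is taken again, now at the root \<open>L 0\<close> for
    \<open>a = 0\<close>.\<close>
  have M: "M (L 0) r 1 C 0 = 2 * of_real pi * \<i> * exp (C * L 0)"
    by (rule exp_zero_contour_integral[OF rR nz[OF V(2)] _ bound[OF V(2)]])
       (use rR \<beta> root[OF U(2)] in auto)
  have "fact (N - 1) * \<beta> ^ Suc (N - 1) * J (L 0) r (Suc (N - 1)) C 0 =
      - M (L 0) r 1 C 0 * (\<Prod>j = 1..N - 1. of_nat j * \<beta> - C)"
    by (rule J_at_0_closed_form[OF _ nz[OF V(2)]]) (use rR in auto)
  then have J: "fact (N - 1) * J (L 0) r N C 0 =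
      - (2 * of_real pi * \<i> * exp (C * L 0)) * (\<Prod>j = 1..N - 1. of_nat j * \<beta> - C) / \<beta> ^ N"
    unfolding N[symmetric] M using \<beta> by (subst nonzero_eq_divide_eq) (simp_all add: mult_ac)
  have "iter_partial w H 0 = - ((- 1) ^ N * exp (C * L 0) * (\<Prod>j = 1..N - 1. of_nat j * \<beta> - C) / \<beta> ^ N)"
    unfolding H[THEN conjunct2] mult.assoc J by simp
  also have "\<dots> = - (exp (C * L 0) / (- \<beta>) ^ N) * (\<Prod>j = 1..N - 1. of_nat j * \<beta> - C)"
    by (simp add: power_minus[of \<beta>] divide_simps)
  finally show ?thesis
    using H iter_partial_cong[OF near] partials_exist_cong[OF near] by simp
qed

end

section \<open>Multi-indices and the return to the surface\<close>

lemma sum_list_map_eq_sum_count_list: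
  fixes h :: "'a::finite \<Rightarrow> 'b::comm_semiring_1"
  shows "(\<Sum>i\<leftarrow>w. h i) = (\<Sum>i\<in>UNIV. of_nat (count_list w i) * h i)"
proof (induction w)
  case (Cons x w)
  have "(\<Sum>i\<in>UNIV. of_nat (count_list (x # w) i) * h i) =
      (\<Sum>i\<in>UNIV. (if i = x then h i else 0) + of_nat (count_list w i) * h i)"
    by (rule sum.cong) (auto simp: distrib_right)
  then show ?case using Cons.IH by (simp add: sum.distrib)
qed simp

theorem theorem1p3:
  fixes \<gamma> :: "complex ^ 'd::finite"
    and b \<beta> :: complex
    and g :: "log_surface \<Rightarrow> complex"
    and f :: "log_surface \<Rightarrow> complex ^ 'd \<Rightarrow> complex"
    and \<alpha> :: log_surface
    and U :: "(complex ^ 'd) set"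
    and \<phi> :: "complex ^ 'd \<Rightarrow> log_surface"
    and n :: "nat ^ 'd"
    and w :: "'d list"
  assumes "b \<noteq> 0" and "\<beta> \<noteq> 0"
    and g_eq: "\<And>z. g z = 1 + b * lpow z \<beta>"
    and "g \<alpha> = 0"
    and f_eq: "\<And>z a. f z a = g z + (\<Sum>i\<in>UNIV. a $ i * lpow z (\<gamma> $ i))"
    and "0 \<in> interior U"
    and "log_surface_smooth_at \<phi> 0"
    and "\<And>a. a \<in> U \<Longrightarrow> f (\<phi> a) a = 0"
    and "\<phi> 0 = \<alpha>"
    and "(\<Sum>i\<in>UNIV. n $ i) \<ge> 1"
    and "\<And>i. count_list w i = n $ i"
  shows "partials_exist w (\<lambda>a. lpow (\<phi> a) 1) 0 \<and>
    iter_partial w (\<lambda>a. lpow (\<phi> a) 1) 0 =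
      - (lpow \<alpha> (1 + (\<Sum>i\<in>UNIV. of_nat (n $ i) * (\<gamma> $ i - 1))) /
         (b * \<beta> * lpow \<alpha> (\<beta> - 1)) ^ (\<Sum>i\<in>UNIV. n $ i)) *
      (\<Prod>j = 1..(\<Sum>i\<in>UNIV. n $ i) - 1.
         - 1 + of_nat j * \<beta> - (\<Sum>i\<in>UNIV. of_nat (n $ i) * \<gamma> $ i))"
proof -
  interpret perturbed_binomial b \<beta> \<gamma> .
  define N where "N = (\<Sum>i\<in>UNIV. n $ i)"
  define G where "G = (\<Sum>i\<in>UNIV. of_nat (n $ i) * \<gamma> $ i)"
  have count: "(\<Sum>i\<leftarrow>w. h i) = (\<Sum>i\<in>UNIV. of_nat (n $ i) * h i)" for h :: "'d \<Rightarrow> complex"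
    by (simp add: sum_list_map_eq_sum_count_list assms(11))
  have len: "length w = N"
    using assms(11) sum_count_set[of w UNIV] by (simp add: N_def)
  have w: "w \<noteq> []" using len assms(10) by (auto simp: N_def)
  have root: "F a (llog (\<phi> a)) = 0" if "a \<in> interior U" for a
    using assms(8)[of a] that interior_subset by (auto simp: F_def f_eq g_eq lpow_eq_exp_llog)
  \<comment> \<open>Since \<open>\<alpha>\<close> is a zero of \<open>g\<close>, the derivative of
    \<open>g\<close> at \<open>\<alpha>\<close> simplifies to \<open>- \<beta>\<close> divided by
    \<open>lpow \<alpha> 1\<close>.\<close>
  have "b * lpow \<alpha> \<beta> = - 1" using assms(4) by (simp add: g_eq add_eq_0_iff)
  moreover have "lpow \<alpha> (\<beta> - 1) = lpow \<alpha> \<beta> * exp (- llog \<alpha>)"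
    by (simp add: lpow_eq_exp_llog left_diff_distrib exp_diff exp_minus divide_inverse)
  ultimately have "b * \<beta> * lpow \<alpha> (\<beta> - 1) = - \<beta> * exp (- llog \<alpha>)"
    by (metis (no_types, opaque_lifting) mult.assoc mult.commute mult_minus1)
  then have den: "(b * \<beta> * lpow \<alpha> (\<beta> - 1)) ^ N = (- \<beta>) ^ N * exp (- (of_nat N * llog \<alpha>))"
    by (simp only: power_mult_distrib) (simp flip: exp_of_nat_mult)
  \<comment> \<open>Splitting \<open>- N\<close> off the exponent gives the factor
    \<open>exp (- (of_nat N * llog \<alpha>))\<close>, which also occurs in \<open>den\<close> and
    cancels.\<close>
  have "1 + (\<Sum>i\<in>UNIV. of_nat (n $ i) * (\<gamma> $ i - 1)) = 1 + G - of_nat N"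
    by (simp add: G_def N_def right_diff_distrib sum_subtractf)
  then have num: "lpow \<alpha> (1 + (\<Sum>i\<in>UNIV. of_nat (n $ i) * (\<gamma> $ i - 1))) =
      exp ((1 + G) * llog \<alpha>) * exp (- (of_nat N * llog \<alpha>))"
    by (simp only: lpow_eq_exp_llog) (simp add: algebra_simps flip: exp_add)
  have "partials_exist w (\<lambda>a. exp (llog (\<phi> a))) 0 \<and>
    iter_partial w (\<lambda>a. exp (llog (\<phi> a))) 0 =
      - (exp ((1 + G) * llog \<alpha>) / (- \<beta>) ^ N) * (\<Prod>j = 1..N - 1. of_nat j * \<beta> - (1 + G))"
    using iterated_partial_exp_root[OF assms(2) open_interior assms(6) _ root w] assms(7,9)
    by (simp add: log_surface_smooth_at_def len count G_def)
  then show ?thesis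
    unfolding N_def[symmetric] G_def[symmetric] num den
    by (simp add: lpow_eq_exp_llog algebra_simps)
qed

end
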